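(* Let $S$ be a dense subsemigroup of $((0,\infty),+)$. Let $M$ be a finite matrix with entries from $\mathbb{Q}$ that is image partition regular over $\mathbb{N}$, and let $N$ be an infinite ($\omega\times\omega$) matrix with entries from $\mathbb{Q}$ that is image partition regular near zero over $S$. Then the matrix $\begin{pmatrix} M & \mathbf{O}\\ \mathbf{O} & N\end{pmatrix}$ is image partition regular near zero over $S$.
   Context: $\omega=\{0,1,2,\ldots\}$, $\mathbb{N}=\{1,2,3,\ldots\}$. "Dense" means dense in $(0,\infty)$ with the usual topology. All matrices have only finitely many nonzero entries in each row, so that $A\vec x$ is defined. $\begin{pmatrix} M & \mathbf{O}\\ \mathbf{O} & N\end{pmatrix}$ is the block diagonal matrix with blocks $M$ and $N$ ($\mathbf{O}$ denotes zero matrices). A $u\times v$ matrix $M$ ($u,v\in\mathbb{N}$) with rational entries is image partition regular over $\mathbb{N}$ if for every finite coloring of $\mathbb{N}$ there is $\vec x\in\mathbb{N}^{v}$ such that all entries of $M\vec x$ lie in $\mathbb{N}$ and have the same color. A matrix $A$ with rational entries and countable column index set $J$ is image partition regular near zero over $S$ if for every finite coloring of $S$ and every $\epsilon>0$ there is $\vec x\in S^{J}$ such that all entries of $A\vec x$ lie in $S\cap(0,\epsilon)$ and have the same color. *)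

theory Defs
  imports "HOL-Analysis.Analysis" "HOL-Library.Countable"
begin

definition dense_subsemigroup :: "real set \<Rightarrow> bool" where
  "dense_subsemigroup S \<longleftrightarrow>
     S \<subseteq> {0<..} \<and> (\<forall>x\<in>S. \<forall>y\<in>S. x + y \<in> S) \<and> {0<..} \<subseteq> closure S"

text \<open>A colouring of \<open>X\<close> is a function whose values outside \<open>X\<close> are irrelevant; colours are
  natural numbers, which is no restriction for finite colourings.\<close>

definition finite_coloring :: "('a \<Rightarrow> nat) \<Rightarrow> 'a set \<Rightarrow> bool" where
  "finite_coloring c X \<longleftrightarrow> finite (c ` X)"

text \<open>Finite \<open>u \<times> v\<close> matrices are of type \<open>rat ^ 'v ^ 'u\<close>. The set of positive integers is
  represented as \<open>{1..} :: nat set\<close>.\<close>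

definition image_partition_regular_nat :: "rat ^ 'v ^ 'u \<Rightarrow> bool" where
  "image_partition_regular_nat M \<longleftrightarrow>
     (\<forall>c :: nat \<Rightarrow> nat. finite_coloring c {1..} \<longrightarrow>
       (\<exists>(x :: nat ^ 'v) k. (\<forall>j. x $ j \<in> {1..}) \<and>
          (\<forall>i. \<exists>n\<in>{1..}. (M *v (\<chi> j. of_nat (x $ j))) $ i = of_nat n \<and> c n = k)))"

text \<open>Possibly infinite matrices are functions of a row index and a column index.\<close>

definition row_finite :: "('i \<Rightarrow> 'j \<Rightarrow> rat) \<Rightarrow> bool" where
  "row_finite A \<longleftrightarrow> (\<forall>i. finite {j. A i j \<noteq> 0})"

text \<open>The sum over the support of a row is the intended product only for row-finite matrices
  (a sum over an infinite set is \<open>0\<close>).\<close>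

definition mat_vec :: "('i \<Rightarrow> 'j \<Rightarrow> rat) \<Rightarrow> ('j \<Rightarrow> real) \<Rightarrow> 'i \<Rightarrow> real" where
  "mat_vec A x i = (\<Sum>j | A i j \<noteq> 0. of_rat (A i j) * x j)"

definition image_partition_regular_near_zero ::
    "real set \<Rightarrow> ('i \<Rightarrow> 'j::countable \<Rightarrow> rat) \<Rightarrow> bool" where
  "image_partition_regular_near_zero S A \<longleftrightarrow>
     row_finite A \<and>
     (\<forall>(c :: real \<Rightarrow> nat) \<epsilon>. finite_coloring c S \<longrightarrow> \<epsilon> > 0 \<longrightarrow>
       (\<exists>x k. (\<forall>j. x j \<in> S) \<and>
          (\<forall>i. mat_vec A x i \<in> S \<inter> {0<..<\<epsilon>} \<and> c (mat_vec A x i) = k)))"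

fun block_diag ::
    "('i1 \<Rightarrow> 'j1 \<Rightarrow> rat) \<Rightarrow> ('i2 \<Rightarrow> 'j2 \<Rightarrow> rat) \<Rightarrow> ('i1 + 'i2) \<Rightarrow> ('j1 + 'j2) \<Rightarrow> rat" where
  "block_diag M N (Inl i) (Inl j) = M i j"
| "block_diag M N (Inl i) (Inr j) = 0"
| "block_diag M N (Inr i) (Inl j) = 0"
| "block_diag M N (Inr i) (Inr j) = N i j"

end

theory Submission
  imports Defs
begin

text \<open>The blocks are made to agree by rescaling. If \<open>c\<close> is a finite colouring of \<open>S\<close>, compactness
  of the space of colourings turns image partition regularity of \<open>M\<close> into a bound \<open>n\<close> such that
  every colouring of \<open>{1..n}\<close> with colours of \<open>c\<close> already admits a monochromatic image of \<open>M\<close>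
  inside \<open>{1..n}\<close> (\<open>image_partition_regular_nat_finite_bound\<close>). Refine \<open>c\<close> by giving \<open>s\<close> the
  tuple \<open>(c (1s), \<dots>, c (ns))\<close>, and choose \<open>y\<close> such that the entries of \<open>Ny\<close> lie below \<open>\<epsilon>/n\<close>
  and agree in the refined colouring. Fix one such entry \<open>a\<close>, and choose \<open>x\<close> such that the entries
  of \<open>Mx\<close> lie in \<open>{1..n}\<close> and agree in the colouring \<open>m \<mapsto> c (ma)\<close>. Let \<open>m\<close> be one of the entries
  of \<open>Mx\<close>. The vector formed from \<open>ax\<close> and \<open>my\<close> works: an entry of \<open>M(ax)\<close> is \<open>m'a\<close> with
  \<open>m'\<close> an entry of \<open>Mx\<close>, so its colour is \<open>c (ma)\<close>, and an entry of \<open>N(my)\<close> is \<open>mb\<close> with \<open>b\<close> an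
  entry of \<open>Ny\<close>, whose colour is also \<open>c (ma)\<close> because \<open>a\<close> and \<open>b\<close> have the same refined colour.\<close>

text \<open>Colourings with colours in a finite set form a compact product space. Since \<open>M\<close> has finitely
  many rows, success of a colouring depends on finitely many of its values and is witnessed inside
  some \<open>{1..n}\<close>. So the sets \<open>U n\<close> of colourings that succeed within \<open>{1..n}\<close> are open, increase with
  \<open>n\<close>, and cover the space; hence one of them is the whole space. The colour \<open>0\<close> is added to \<open>K\<close>
  only to extend colourings of \<open>{1..n}\<close> to all natural numbers.\<close>

lemma image_partition_regular_nat_finite_bound:
  fixes M :: "rat ^ 'v ^ 'u" and K :: "nat set"
  assumes "image_partition_regular_nat M" and "finite K"
  shows "\<exists>n. \<forall>c. c ` {1..n} \<subseteq> K \<longrightarrow>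
    (\<exists>(x :: nat ^ 'v) k. (\<forall>j. x $ j \<in> {1..}) \<and>
       (\<forall>i. \<exists>m\<in>{1..n}. (M *v (\<chi> j. of_nat (x $ j))) $ i = of_nat m \<and> c m = k))"
proof -
  define P :: "nat ^ 'v \<Rightarrow> 'u \<Rightarrow> nat \<Rightarrow> bool"
    where "P x i m \<longleftrightarrow> (M *v (\<chi> j. of_nat (x $ j))) $ i = of_nat m" for x i m
  \<comment> \<open>Written with unions and finite intersections of cylinder sets so that openness is immediate.\<close>
  define U :: "nat \<Rightarrow> (nat \<Rightarrow> nat) set" where
    "U n = (\<Union>x\<in>{x. \<forall>j. x $ j \<in> {1..}}. \<Union>k. \<Inter>i. \<Union>m\<in>{m \<in> {1..n}. P x i m}. {c. c m = k})" for n
  have U_iff: "c \<in> U n \<longleftrightarrow> (\<exists>x k. (\<forall>j. x $ j \<in> {1..}) \<and> (\<forall>i. \<exists>m\<in>{1..n}. P x i m \<and> c m = k))"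
    for c n
    unfolding U_def UN_iff INT_iff mem_Collect_eq Bex_def Ball_def by simp
  define C where "C = (UNIV :: nat set) \<rightarrow>\<^sub>E insert 0 K"
  have "compactin (product_topology (\<lambda>_. euclidean) UNIV) C"
    using \<open>finite K\<close> unfolding C_def
    by (auto simp: compactin_PiE finite_imp_compact)
  then have C_compact: "compact C"
    by (simp add: euclidean_product_topology compactin_euclidean_iff)
  have U_open: "open (U n)" for n
  proof -
    have "open {c :: nat \<Rightarrow> nat. c m = k}" for m k
      using open_vimage[OF open_discrete[of "{k}"], of "\<lambda>c. c m"]
      by (auto simp: vimage_def intro: continuous_on_product_coordinates)
    then show ?thesis
      unfolding U_def by (intro open_UN open_INT ballI finite_class.finite_UNIV) auto
  qed
  have U_mono: "U n \<subseteq> U n'" if "n \<le> n'" for n n'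
  proof
    fix c assume "c \<in> U n"
    then obtain x k where "\<forall>j. x $ j \<in> {1..}" "\<forall>i. \<exists>m\<in>{1..n}. P x i m \<and> c m = k"
      unfolding U_iff by blast
    moreover have "{1..n} \<subseteq> {1..n'}"
      using that by simp
    ultimately show "c \<in> U n'"
      unfolding U_iff by (meson subsetD)
  qed
  have C_cover: "C \<subseteq> (\<Union>n. U n)"
  proof
    fix c assume "c \<in> C"
    then have "c ` {1..} \<subseteq> insert 0 K"
      by (auto simp: C_def)
    then have "finite_coloring c {1..}"
      unfolding finite_coloring_def using \<open>finite K\<close> by (meson finite_insert finite_subset)
    then obtain x k where x: "\<forall>j. x $ j \<in> {1..}" "\<forall>i. \<exists>m\<in>{1..}. P x i m \<and> c m = k"
      using assms(1) unfolding image_partition_regular_nat_def P_def by blast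
    then obtain m where m: "\<And>i. m i \<in> {1..}" "\<And>i. P x i (m i)" "\<And>i. c (m i) = k"
      by metis
    \<comment> \<open>There are finitely many rows, so the entries of the image are bounded.\<close>
    have "m i \<le> Max (range m)" for i
      by simp
    then have "\<forall>i. \<exists>m\<in>{1..Max (range m)}. P x i m \<and> c m = k"
      using m by (meson atLeastAtMost_iff atLeast_iff)
    then have "c \<in> U (Max (range m))"
      unfolding U_iff using x(1) by blast
    then show "c \<in> (\<Union>n. U n)" by blast
  qed
  obtain D where D: "finite D" "C \<subseteq> (\<Union>n\<in>D. U n)"
    by (rule compactE_image[OF C_compact U_open C_cover]) blast
  define n where "n = Max (insert 0 D)"
  have C_U: "C \<subseteq> U n"
  proof -
    have "d \<le> n" if "d \<in> D" for d
      using that D(1) by (simp add: n_def)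
    then show ?thesis using D(2) U_mono by blast
  qed
  have "\<exists>(x :: nat ^ 'v) k. (\<forall>j. x $ j \<in> {1..}) \<and> (\<forall>i. \<exists>m\<in>{1..n}. P x i m \<and> c m = k)"
    if "c ` {1..n} \<subseteq> K" for c
  proof -
    have "(\<lambda>m. if m \<in> {1..n} then c m else 0) \<in> C"
      using that unfolding image_subset_iff C_def by auto
    then have "(\<lambda>m. if m \<in> {1..n} then c m else 0) \<in> U n"
      using C_U by blast
    then obtain x k where x: "\<forall>j. x $ j \<in> {1..}"
      "\<forall>i. \<exists>m\<in>{1..n}. P x i m \<and> (if m \<in> {1..n} then c m else 0) = k"
      unfolding U_iff by blast
    then have "\<forall>i. \<exists>m\<in>{1..n}. P x i m \<and> c m = k"
      by (metis (no_types, lifting))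
    with x(1) show ?thesis by blast
  qed
  then show ?thesis unfolding P_def by blast
qed

lemma dense_subsemigroup_scale:
  assumes "dense_subsemigroup S" and "s \<in> S" and "1 \<le> m"
  shows "real m * s \<in> S"
  using \<open>1 \<le> m\<close>
proof (induction m rule: nat_induct_at_least)
  case base
  then show ?case using assms by simp
next
  case (Suc m)
  then have "real m * s + s \<in> S"
    using assms unfolding dense_subsemigroup_def by blast
  then show ?case by (simp add: algebra_simps)
qed

lemma mat_vec_scale: "mat_vec A (\<lambda>j. a * x j) i = a * mat_vec A x i"
  by (simp add: mat_vec_def sum_distrib_left algebra_simps)

lemma mat_vec_finite:
  fixes M :: "rat ^ 'v ^ 'u" and x :: "rat ^ 'v"
  shows "mat_vec (\<lambda>i j. M $ i $ j) (\<lambda>j. of_rat (x $ j)) i = of_rat ((M *v x) $ i)"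
  unfolding mat_vec_def matrix_vector_mult_def
  by (simp add: of_rat_sum of_rat_mult) (rule sum.mono_neutral_left; simp)

lemma block_diag_support:
  "{j. block_diag M N (Inl i) j \<noteq> 0} = Inl ` {j. M i j \<noteq> 0}"
  "{j. block_diag M N (Inr i') j \<noteq> 0} = Inr ` {j. N i' j \<noteq> 0}"
proof -
  have "block_diag M N (Inl i) j \<noteq> 0 \<longleftrightarrow> j \<in> Inl ` {j. M i j \<noteq> 0}" for j
    by (cases j) auto
  then show "{j. block_diag M N (Inl i) j \<noteq> 0} = Inl ` {j. M i j \<noteq> 0}" by blast
  have "block_diag M N (Inr i') j \<noteq> 0 \<longleftrightarrow> j \<in> Inr ` {j. N i' j \<noteq> 0}" for j
    by (cases j) auto
  then show "{j. block_diag M N (Inr i') j \<noteq> 0} = Inr ` {j. N i' j \<noteq> 0}" by blast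
qed

lemma row_finite_block_diag:
  assumes "row_finite M" and "row_finite N"
  shows "row_finite (block_diag M N)"
  unfolding row_finite_def
proof
  fix i
  show "finite {j. block_diag M N i j \<noteq> 0}"
    using assms by (cases i) (auto simp: block_diag_support row_finite_def)
qed

lemma mat_vec_block_diag:
  "mat_vec (block_diag M N) (case_sum x y) (Inl i) = mat_vec M x i"
  "mat_vec (block_diag M N) (case_sum x y) (Inr i') = mat_vec N y i'"
  unfolding mat_vec_def block_diag_support by (simp_all add: sum.reindex)

theorem theorem2p3:
  fixes S :: "real set"
    and M :: "rat ^ 'v ^ 'u"
    and N :: "nat \<Rightarrow> nat \<Rightarrow> rat"
  assumes "dense_subsemigroup S"
    and "image_partition_regular_nat M"
    and "image_partition_regular_near_zero S N"
  shows "image_partition_regular_near_zero S (block_diag (\<lambda>i j. M $ i $ j) N)"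
proof -
  let ?M = "\<lambda>i j. M $ i $ j"
  have "row_finite ?M"
    by (simp add: row_finite_def)
  then have row_finite: "row_finite (block_diag ?M N)"
    using assms(3) by (simp add: row_finite_block_diag image_partition_regular_near_zero_def)
  have "\<exists>z k. (\<forall>j. z j \<in> S) \<and>
      (\<forall>i. mat_vec (block_diag ?M N) z i \<in> S \<inter> {0<..<\<epsilon>} \<and> c (mat_vec (block_diag ?M N) z i) = k)"
    if c: "finite_coloring c S" and "\<epsilon> > 0" for c :: "real \<Rightarrow> nat" and \<epsilon>
  proof -
    have "finite (c ` S)"
      using c by (simp add: finite_coloring_def)
    then obtain n where n: "\<And>\<gamma>. \<gamma> ` {1..n} \<subseteq> c ` S \<Longrightarrow>
        \<exists>(x :: nat ^ 'v) k. (\<forall>j. x $ j \<in> {1..}) \<and>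
          (\<forall>i. \<exists>m\<in>{1..n}. (M *v (\<chi> j. of_nat (x $ j))) $ i = of_nat m \<and> \<gamma> m = k)"
      using image_partition_regular_nat_finite_bound[OF assms(2)] by metis
    define tuple where "tuple s = map (\<lambda>m. c (real m * s)) [1..<Suc n]" for s
    have "tuple ` S \<subseteq> {l. set l \<subseteq> c ` S \<and> length l = n}"
      using dense_subsemigroup_scale[OF assms(1)] by (auto simp: tuple_def)
    then have "finite (tuple ` S)"
      using finite_lists_length_eq[OF \<open>finite (c ` S)\<close>] finite_subset by blast
    then have "finite_coloring (to_nat \<circ> tuple) S"
      unfolding finite_coloring_def image_comp[symmetric] by (rule finite_imageI)
    \<comment> \<open>The denominator \<open>n + 1\<close> is nonzero without a case distinction on \<open>n\<close>.\<close>
    moreover have "\<epsilon> / (real n + 1) > 0"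
      using \<open>\<epsilon> > 0\<close> by simp
    ultimately obtain y l where y: "\<And>j. y j \<in> S"
      "\<And>i. mat_vec N y i \<in> S \<inter> {0<..<\<epsilon> / (real n + 1)}" "\<And>i. to_nat (tuple (mat_vec N y i)) = l"
      using assms(3) unfolding image_partition_regular_near_zero_def comp_def by metis
    define a where "a = mat_vec N y 0"
    have "a \<in> S"
      using y(2) by (auto simp: a_def)
    have color: "c (real m * mat_vec N y i) = c (real m * a)" if "m \<in> {1..n}" for m i
    proof -
      have "tuple (mat_vec N y i) = tuple a"
        using y(3) unfolding a_def by (metis injD inj_to_nat)
      then show ?thesis
        using that by (auto simp: tuple_def simp del: upt_Suc)
    qed
    have small: "real m * mat_vec N y i \<in> S \<inter> {0<..<\<epsilon>}" if "m \<in> {1..n}" for m i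
    proof -
      have b: "mat_vec N y i \<in> S" "0 < mat_vec N y i" "mat_vec N y i * (real n + 1) < \<epsilon>"
        using y(2)[of i] by (auto simp: field_simps)
      have "real m * mat_vec N y i \<le> mat_vec N y i * (real n + 1)"
        using that b(2) by (simp add: mult.commute)
      then have "real m * mat_vec N y i < \<epsilon>"
        using b(3) by linarith
      then show ?thesis
        using that b(2) dense_subsemigroup_scale[OF assms(1) b(1)] by auto
    qed
    have "(\<lambda>m. c (real m * a)) ` {1..n} \<subseteq> c ` S"
      using dense_subsemigroup_scale[OF assms(1) \<open>a \<in> S\<close>] by auto
    then obtain x :: "nat ^ 'v" and k where x: "\<And>j. x $ j \<in> {1..}"
      "\<And>i. \<exists>m\<in>{1..n}. (M *v (\<chi> j. of_nat (x $ j))) $ i = of_nat m \<and> c (real m * a) = k"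
      using n[of "\<lambda>m. c (real m * a)"] by blast
    obtain m where m: "m \<in> {1..n}" "c (real m * a) = k"
      using x(2) by blast
    define z where "z = case_sum (\<lambda>j. a * real (x $ j)) (\<lambda>j. real m * y j)"
    have "z j \<in> S" for j
      using x(1) m(1) y(1) \<open>a \<in> S\<close> dense_subsemigroup_scale[OF assms(1)]
      by (auto simp: z_def mult.commute[of a] split: sum.split)
    moreover have "mat_vec (block_diag ?M N) z i \<in> S \<inter> {0<..<\<epsilon>} \<and>
        c (mat_vec (block_diag ?M N) z i) = k" for i
    proof (cases i)
      case (Inl i')
      obtain m' where m': "m' \<in> {1..n}" "c (real m' * a) = k"
        "(M *v (\<chi> j. of_nat (x $ j))) $ i' = of_nat m'"
        using x(2) by blast
      have "mat_vec (block_diag ?M N) z i = a * mat_vec ?M (\<lambda>j. real (x $ j)) i'"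
        by (simp add: Inl z_def mat_vec_block_diag mat_vec_scale)
      also have "\<dots> = real m' * a"
        using mat_vec_finite[of M "\<chi> j. of_nat (x $ j)" i'] m'(3) by simp
      finally show ?thesis
        using m' small[of m' 0] by (simp add: a_def)
    next
      case (Inr i')
      then have "mat_vec (block_diag ?M N) z i = real m * mat_vec N y i'"
        by (simp add: z_def mat_vec_block_diag mat_vec_scale)
      then show ?thesis
        using m color small by simp
    qed
    ultimately show ?thesis by blast
  qed
  then show ?thesis
    using row_finite unfolding image_partition_regular_near_zero_def by blast
qed

end
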